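(* The approximation factor of Double Proposal for the marriage model satisfies $$\max_{I\in\mathcal I_{\rm Marriage}}\frac{\mathrm{OPT}(I)}{\mathrm{ALG}(I)}=1.5,$$ where $\mathcal I_{\rm Marriage}$ is the family of instances of HRT-MSLQ in which every hospital has upper quota $1$. Moreover, this is best possible for the marriage model if strategy-proofness is required: there is no deterministic algorithm $A$ (regardless of running time) that maps each instance $I\in\mathcal I_{\rm Marriage}$ to a stable matching $A(I)$ of $I$, is strategy-proof for residents, and satisfies $\mathrm{OPT}(I)\le c\cdot s(A(I))$ for all $I\in\mathcal I_{\rm Marriage}$ for some constant $c<1.5$.
   Context: Problem. An instance $I$ of HRT-MSLQ consists of a set $R=\{r_1,\dots,r_n\}$ of residents ($n\ge 1$) and a set $H=\{h_1,\dots,h_m\}$ of hospitals (agents are indexed). Each resident $r$ has a complete preference list over $H$ that may contain ties (a total preorder $\succeq_r$; $\succ_r$ is strict preference, $=_r$ indifference), and each hospital $h$ likewise has a complete preference list over $R$ that may contain ties. Each hospital $h$ has an integer lower quota $\ell(h)$ and upper quota $u(h)$ with $0\le \ell(h)\le u(h)\le n$, $u(h)\ge 1$ (so in the marriage model $[\ell(h),u(h)]\in\{[0,1],[1,1]\}$). Standing assumption: $|R|<\sum_{h\in H}u(h)$. An assignment is a set $M\subseteq R\times H$; $M(r)=\{h:(r,h)\in M\}$, $M(h)=\{r:(r,h)\in M\}$. $M$ is a matching if $|M(r)|\le 1$ for all $r$ and $|M(h)|\le u(h)$ for all $h$; then $M(r)$ also denotes the unique hospital of a matched resident $r$. A pair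 $(r,h)$ blocks a matching $M$ if (i) $r$ is unmatched in $M$ or $h\succ_r M(r)$, and (ii) $|M(h)|<u(h)$ or $h$ strictly prefers $r$ to at least one resident in $M(h)$. $M$ is stable if no pair blocks it (under the standing assumption every resident is matched in every stable matching). The score of $h$ in $M$ is $s_M(h)=\min\{1,|M(h)|/\ell(h)\}$, with $s_M(h)=1$ if $\ell(h)=0$; the score of $M$ is $s(M)=\sum_{h\in H}s_M(h)$. $\mathrm{OPT}(I)$ is the maximum of $s(M)$ over stable matchings $M$ of $I$. $\mathrm{ALG}(I)$ is the score of the output of Double Proposal on $I$. Strategy-proofness. An algorithm $A$ is strategy-proof for residents if, for every instance $I$, every resident $r$ with preference $\succeq_r$ in $I$, and every instance $I'$ obtained from $I$ by replacing $\succeq_r$ by another list $\succeq_r'$, the outputs $M=A(I)$, $M'=A(I')$ satisfy $M(r)\succeq_r M'(r)$. Algorithm Double Proposal (deterministic). Regard a hospital not in any tie of a resident's list as a tie of length one. Start with $M:=\emptyset$. While some resident is unmatched in $M$: let $r$ be the unmatched resident with smallest index and $T$ the top tie of $r$'s current list. If $T$ contains a hospital to which $r$ has not yet proposed, let $h$ be such a hospital with minimum $\ell(h)$; otherwise let $h$ be a hospital in $T$ with minimum $\ell(h)$ (in both cases break remaining ties by smallest hospital index). Resident $r$ proposes to $h$, and then: (1) if $|M(h)|<\ell(h)$, set $M:=M\cup\{(r,h)\}$; (2) else, if some resident in $M(h)\cup\{r\}$ has not been rejected by $h$ so far, let $r'$ be the one among such residents with the largest index (possibly $r'=r$) and set $M:=(M\cup\{(r,h)\})\setminus\{(r',h)\}$;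 (3) else, if $|M(h)|<u(h)$, set $M:=M\cup\{(r,h)\}$; (4) else, let $r'$ be a resident in $M(h)\cup\{r\}$ that is worst for $h$ (the one with largest index if there are several; possibly $r'=r$), set $M:=(M\cup\{(r,h)\})\setminus\{(r',h)\}$, and delete $h$ from the list of $r'$. In (2) and (4), $r'$ is said to be rejected by $h$. When no resident is unmatched, output $M$. (The output is a stable matching.) *)

theory Defs
  imports Complex_Main "HOL-Library.While_Combinator"
begin

text \<open>
  Residents are the numbers below \<open>nres I\<close>, hospitals the numbers below \<open>nhosp I\<close>; the agent with
  index \<open>i + 1\<close> in one-based counting is the number \<open>i\<close>.  A preference list with ties is a total
  preorder, where \<open>(x, y) \<in> P\<close> means that \<open>x\<close> is weakly preferred to \<open>y\<close>.
\<close>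

record instance_data =
  nres :: nat
  nhosp :: nat
  rpref :: "nat \<Rightarrow> nat rel"
  hpref :: "nat \<Rightarrow> nat rel"
  lq :: "nat \<Rightarrow> nat"
  uq :: "nat \<Rightarrow> nat"

type_synonym assignment = "(nat \<times> nat) set"

abbreviation residents :: "instance_data \<Rightarrow> nat set" where
  "residents I \<equiv> {..<nres I}"

abbreviation hospitals :: "instance_data \<Rightarrow> nat set" where
  "hospitals I \<equiv> {..<nhosp I}"

definition pref_list :: "nat set \<Rightarrow> nat rel \<Rightarrow> bool" where
  "pref_list A P \<longleftrightarrow> preorder_on A P \<and> total_on A P"

definition strictly_prefers :: "nat rel \<Rightarrow> nat \<Rightarrow> nat \<Rightarrow> bool" where
  "strictly_prefers P x y \<longleftrightarrow> (x, y) \<in> P \<and> (y, x) \<notin> P"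

definition hrt_mslq :: "instance_data set" where
  "hrt_mslq = {I. nres I \<ge> 1 \<and>
     (\<forall>r\<in>residents I. pref_list (hospitals I) (rpref I r)) \<and>
     (\<forall>h\<in>hospitals I. pref_list (residents I) (hpref I h)) \<and>
     (\<forall>h\<in>hospitals I. lq I h \<le> uq I h \<and> uq I h \<le> nres I \<and> 1 \<le> uq I h) \<and>
     nres I < (\<Sum>h\<in>hospitals I. uq I h)}"

definition marriage :: "instance_data set" where
  "marriage = {I \<in> hrt_mslq. \<forall>h\<in>hospitals I. uq I h = 1}"

definition hospitals_of :: "assignment \<Rightarrow> nat \<Rightarrow> nat set" where
  "hospitals_of M r = {h. (r, h) \<in> M}"

definition residents_of :: "assignment \<Rightarrow> nat \<Rightarrow> nat set" where
  "residents_of M h = {r. (r, h) \<in> M}"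

definition unmatched :: "assignment \<Rightarrow> nat \<Rightarrow> bool" where
  "unmatched M r \<longleftrightarrow> hospitals_of M r = {}"

text \<open>Only meaningful if \<open>r\<close> is matched in the matching \<open>M\<close>.\<close>

definition hospital_of :: "assignment \<Rightarrow> nat \<Rightarrow> nat" where
  "hospital_of M r = (THE h. (r, h) \<in> M)"

definition matching :: "instance_data \<Rightarrow> assignment \<Rightarrow> bool" where
  "matching I M \<longleftrightarrow> M \<subseteq> residents I \<times> hospitals I \<and>
     (\<forall>r\<in>residents I. card (hospitals_of M r) \<le> 1) \<and>
     (\<forall>h\<in>hospitals I. card (residents_of M h) \<le> uq I h)"

definition blocks :: "instance_data \<Rightarrow> assignment \<Rightarrow> nat \<Rightarrow> nat \<Rightarrow> bool" where
  "blocks I M r h \<longleftrightarrow>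
     (unmatched M r \<or> strictly_prefers (rpref I r) h (hospital_of M r)) \<and>
     (card (residents_of M h) < uq I h \<or>
       (\<exists>r'\<in>residents_of M h. strictly_prefers (hpref I h) r r'))"

definition stable_matching :: "instance_data \<Rightarrow> assignment \<Rightarrow> bool" where
  "stable_matching I M \<longleftrightarrow> matching I M \<and>
     \<not> (\<exists>r\<in>residents I. \<exists>h\<in>hospitals I. blocks I M r h)"

definition hospital_score :: "instance_data \<Rightarrow> assignment \<Rightarrow> nat \<Rightarrow> real" where
  "hospital_score I M h =
     (if lq I h = 0 then 1 else min 1 (real (card (residents_of M h)) / real (lq I h)))"

definition score :: "instance_data \<Rightarrow> assignment \<Rightarrow> real" where
  "score I M = (\<Sum>h\<in>hospitals I. hospital_score I M h)"

definition OPT :: "instance_data \<Rightarrow> real" where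
  "OPT I = Max (score I ` {M. stable_matching I M})"

text \<open>
  State of Double Proposal: the current assignment and, as sets of pairs (resident, hospital), the
  proposals made so far, the rejections made so far, and the deletions from the residents' lists.
\<close>

record dp_state =
  asg :: assignment
  proposed :: "(nat \<times> nat) set"
  rejected :: "(nat \<times> nat) set"
  deleted :: "(nat \<times> nat) set"

definition dp_init :: dp_state where
  "dp_init = \<lparr>asg = {}, proposed = {}, rejected = {}, deleted = {}\<rparr>"

definition unmatched_residents :: "instance_data \<Rightarrow> dp_state \<Rightarrow> nat set" where
  "unmatched_residents I s = {r \<in> residents I. unmatched (asg s) r}"

definition current_list :: "instance_data \<Rightarrow> dp_state \<Rightarrow> nat \<Rightarrow> nat set" where
  "current_list I s r = {h \<in> hospitals I. (r, h) \<notin> deleted s}"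

definition top_tie :: "instance_data \<Rightarrow> dp_state \<Rightarrow> nat \<Rightarrow> nat set" where
  "top_tie I s r =
     {h \<in> current_list I s r. \<forall>h'\<in>current_list I s r. (h, h') \<in> rpref I r}"

definition proposal_candidates :: "instance_data \<Rightarrow> dp_state \<Rightarrow> nat \<Rightarrow> nat set" where
  "proposal_candidates I s r =
     (let T = top_tie I s r; T' = {h \<in> T. (r, h) \<notin> proposed s} in
      if T' \<noteq> {} then T' else T)"

definition proposal_target :: "instance_data \<Rightarrow> dp_state \<Rightarrow> nat \<Rightarrow> nat" where
  "proposal_target I s r =
     (let C = proposal_candidates I s r in Min {h \<in> C. \<forall>h'\<in>C. lq I h \<le> lq I h'})"

definition worst :: "nat rel \<Rightarrow> nat set \<Rightarrow> nat" where
  "worst P X = Max {x \<in> X. \<forall>y\<in>X. (y, x) \<in> P}"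

definition dp_step :: "instance_data \<Rightarrow> dp_state \<Rightarrow> dp_state" where
  "dp_step I s =
     (let r = Min (unmatched_residents I s);
          h = proposal_target I s r;
          M = asg s;
          k = card (residents_of M h);
          X = insert r (residents_of M h);
          F = {x \<in> X. (x, h) \<notin> rejected s};
          s' = s\<lparr>proposed := insert (r, h) (proposed s)\<rparr>
      in if k < lq I h then s'\<lparr>asg := insert (r, h) M\<rparr>
         else if F \<noteq> {} then
           (let r' = Max F in
            s'\<lparr>asg := insert (r, h) M - {(r', h)},
               rejected := insert (r', h) (rejected s)\<rparr>)
         else if k < uq I h then s'\<lparr>asg := insert (r, h) M\<rparr>
         else
           (let r' = worst (hpref I h) X in
            s'\<lparr>asg := insert (r, h) M - {(r', h)},
               rejected := insert (r', h) (rejected s),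
               deleted := insert (r', h) (deleted s)\<rparr>))"

definition double_proposal :: "instance_data \<Rightarrow> assignment" where
  "double_proposal I =
     asg (while (\<lambda>s. unmatched_residents I s \<noteq> {}) (dp_step I) dp_init)"

definition ALG :: "instance_data \<Rightarrow> real" where
  "ALG I = score I (double_proposal I)"

text \<open>Strategy-proofness for residents of an algorithm whose inputs are the instances in \<open>\<I>\<close>.\<close>

definition strategy_proof ::
    "instance_data set \<Rightarrow> (instance_data \<Rightarrow> assignment) \<Rightarrow> bool" where
  "strategy_proof \<I> A \<longleftrightarrow>
     (\<forall>I\<in>\<I>. \<forall>r\<in>residents I. \<forall>P. \<forall>I'\<in>\<I>.
        I' = I\<lparr>rpref := (rpref I)(r := P)\<rparr> \<longrightarrow>
        (hospital_of (A I) r, hospital_of (A I') r) \<in> rpref I r)"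

end

theory Submission
  imports Defs
begin

text \<open>
  Compare the output \<open>M\<close> with an optimal stable matching \<open>N\<close>.  The symmetric difference consists of
  cycles and of paths between hospitals, and \<open>N\<close> gains at most one hospital on a path; the factor
  \<open>3/2\<close> can fail only on a path with a single resident \<open>r\<close>.  There \<open>r\<close> is indifferent between a
  hospital \<open>N(r)\<close> of lower quota 1, empty in \<open>M\<close>, and a hospital \<open>M(r)\<close> of lower quota 0.  But a
  hospital of lower quota 0 accepts only repeated proposals, so \<open>r\<close> must have proposed to \<open>N(r)\<close>,
  and a hospital of lower quota 1 stays filled from its first proposal on.
\<close>

subsection \<open>Stable matchings in the marriage model\<close>

text \<open>The constant comes from charging. The hospital after a gain on its path is either filled
  by \<open>N\<close> with a resident whose own hospital in \<open>N\<close> is no gain, or is lost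
  by \<open>N\<close>. So, with n residents, twice the gains are at most n plus the losses, while n
  is at most the score of \<open>M\<close>, as every resident is matched and satisfies its hospital.
  The obstacle is that the facts about Double Proposal concern history (first and repeated
  proposals), but a loop proof sees only the current state; the recorded proposals, rejections and
  deletions turn history into an invariant. Both lower bounds use the shortest path on which a gain
  can survive: two residents and three hospitals, one of lower quota 0. Stable matchings then score
  2 or 3, so a factor below 3/2 forces 3 wherever 3 is attainable.\<close>

lemma marriage_lq:
  assumes "I \<in> marriage" "h \<in> hospitals I"
  shows "lq I h = 0 \<or> lq I h = 1"
proof -
  have "lq I h \<le> uq I h" "uq I h = 1"
    using assms by (auto simp: marriage_def hrt_mslq_def)
  then show ?thesis by auto
qed

lemma marriage_uq: "I \<in> marriage \<Longrightarrow> h \<in> hospitals I \<Longrightarrow> uq I h = 1"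
  by (auto simp: marriage_def)

lemma marriage_nres_less: "I \<in> marriage \<Longrightarrow> nres I < nhosp I"
proof -
  assume "I \<in> marriage"
  then have "nres I < (\<Sum>h\<in>hospitals I. uq I h)"
    "(\<Sum>h\<in>hospitals I. uq I h) = (\<Sum>h\<in>hospitals I. 1)"
    unfolding marriage_def hrt_mslq_def by (auto intro: sum.cong)
  then show ?thesis by simp
qed

lemma marriage_nres_pos: "I \<in> marriage \<Longrightarrow> 0 < nres I"
  by (auto simp: marriage_def hrt_mslq_def)

lemma marriage_rpref: "I \<in> marriage \<Longrightarrow> r \<in> residents I \<Longrightarrow> pref_list (hospitals I) (rpref I r)"
  by (auto simp: marriage_def hrt_mslq_def)

lemma marriage_hpref: "I \<in> marriage \<Longrightarrow> h \<in> hospitals I \<Longrightarrow> pref_list (residents I) (hpref I h)"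
  by (auto simp: marriage_def hrt_mslq_def)

lemma pref_list_refl: "pref_list A P \<Longrightarrow> x \<in> A \<Longrightarrow> (x, x) \<in> P"
  by (auto simp: pref_list_def preorder_on_def dest: refl_onD)

lemma pref_list_trans: "pref_list A P \<Longrightarrow> (x, y) \<in> P \<Longrightarrow> (y, z) \<in> P \<Longrightarrow> (x, z) \<in> P"
  by (auto simp: pref_list_def preorder_on_def dest: transD)

lemma pref_list_total: "pref_list A P \<Longrightarrow> x \<in> A \<Longrightarrow> y \<in> A \<Longrightarrow> (x, y) \<in> P \<or> (y, x) \<in> P"
  using pref_list_refl[of A P x] by (cases "x = y") (auto simp: pref_list_def total_on_def)

lemma finite_pref_list_has_top:
  assumes "pref_list A P" "finite B" "B \<noteq> {}" "B \<subseteq> A"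
  shows "\<exists>x\<in>B. \<forall>y\<in>B. (x, y) \<in> P"
  using assms(2-4)
proof (induction B rule: finite_ne_induct)
  case (singleton x)
  then show ?case using pref_list_refl[OF assms(1)] by auto
next
  case (insert x B)
  then obtain b where b: "b \<in> B" "\<forall>y\<in>B. (b, y) \<in> P" by auto
  show ?case
  proof (cases "(b, x) \<in> P")
    case True
    then show ?thesis using b by auto
  next
    case False
    then have xb: "(x, b) \<in> P" using pref_list_total[OF assms(1)] b insert.prems by blast
    then have "(x, y) \<in> P" if "y \<in> B" for y
      using pref_list_trans[OF assms(1)] b that by blast
    moreover have "(x, x) \<in> P" using pref_list_refl[OF assms(1)] insert.prems by auto
    ultimately show ?thesis by auto
  qed
qed

lemma finite_pref_list_has_worst:
  assumes "pref_list A P" "finite B" "B \<noteq> {}" "B \<subseteq> A"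
  shows "\<exists>x\<in>B. \<forall>y\<in>B. (y, x) \<in> P"
proof -
  have "pref_list A (P\<inverse>)"
    using assms(1) by (auto simp: pref_list_def preorder_on_def total_on_def)
  then show ?thesis using finite_pref_list_has_top[of A "P\<inverse>" B] assms(2-4) by auto
qed

lemma worst_in:
  assumes "pref_list A P" "finite B" "B \<noteq> {}" "B \<subseteq> A"
  shows "worst P B \<in> B" and "\<forall>y\<in>B. (y, worst P B) \<in> P"
proof -
  have "worst P B \<in> {x \<in> B. \<forall>y\<in>B. (y, x) \<in> P}"
    unfolding worst_def
    using finite_pref_list_has_worst[OF assms] assms(2) by (intro Max_in) auto
  then show "worst P B \<in> B" and "\<forall>y\<in>B. (y, worst P B) \<in> P" by auto
qed

lemma card_le_one_unique: "finite A \<Longrightarrow> card A \<le> 1 \<Longrightarrow> x \<in> A \<Longrightarrow> y \<in> A \<Longrightarrow> x = y"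
  by (metis card_le_Suc0_iff_eq One_nat_def)

lemma finite_matching_sets:
  assumes "M \<subseteq> residents I \<times> hospitals I"
  shows "finite M" "finite (hospitals_of M r)" "finite (residents_of M h)"
proof -
  show "finite M" using assms finite_subset by blast
  have "hospitals_of M r \<subseteq> hospitals I" "residents_of M h \<subseteq> residents I"
    using assms by (auto simp: hospitals_of_def residents_of_def)
  then show "finite (hospitals_of M r)" "finite (residents_of M h)"
    using finite_subset by blast+
qed

lemma matching_right_unique:
  assumes "matching I M" "(r, h) \<in> M" "(r, h') \<in> M"
  shows "h = h'"
proof (rule card_le_one_unique)
  show "finite (hospitals_of M r)" "card (hospitals_of M r) \<le> 1"
    using assms finite_matching_sets by (auto simp: matching_def)
  show "h \<in> hospitals_of M r" "h' \<in> hospitals_of M r"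
    using assms by (auto simp: hospitals_of_def)
qed

lemma hospital_of_eq:
  assumes "matching I M" "(r, h) \<in> M"
  shows "hospital_of M r = h"
  unfolding hospital_of_def using assms matching_right_unique by blast

lemma marriage_left_unique:
  assumes "I \<in> marriage" "matching I M" "(r, h) \<in> M" "(r', h) \<in> M"
  shows "r = r'"
proof (rule card_le_one_unique)
  have "h \<in> hospitals I" using assms by (auto simp: matching_def)
  then show "card (residents_of M h) \<le> 1"
    using assms(1,2) marriage_uq[of I h] by (metis matching_def)
  show "finite (residents_of M h)"
    using assms finite_matching_sets by (auto simp: matching_def)
  show "r \<in> residents_of M h" "r' \<in> residents_of M h"
    using assms by (auto simp: residents_of_def)
qed

lemma marriage_matchingI:
  assumes "I \<in> marriage" "M \<subseteq> residents I \<times> hospitals I"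
    and "\<And>r h h'. (r, h) \<in> M \<Longrightarrow> (r, h') \<in> M \<Longrightarrow> h = h'"
    and "\<And>r r' h. (r, h) \<in> M \<Longrightarrow> (r', h) \<in> M \<Longrightarrow> r = r'"
  shows "matching I M"
proof -
  have "card (hospitals_of M r) \<le> Suc 0" for r
    using finite_matching_sets[OF assms(2)] assms(3)
    by (subst card_le_Suc0_iff_eq) (auto simp: hospitals_of_def)
  moreover have "card (residents_of M h) \<le> Suc 0" for h
    using finite_matching_sets[OF assms(2)] assms(4)
    by (subst card_le_Suc0_iff_eq) (auto simp: residents_of_def)
  ultimately show ?thesis
    using assms(1,2) by (auto simp: matching_def marriage_uq)
qed

text \<open>Pigeonhole: upper quotas 1 turn the standing assumption into fewer residents than
  hospitals, and uniqueness of a resident's hospital makes any choice of occupants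
  injective.\<close>

lemma marriage_unfilled_hospital:
  assumes "I \<in> marriage" "M \<subseteq> residents I \<times> hospitals I"
    and "\<And>r h h'. (r, h) \<in> M \<Longrightarrow> (r, h') \<in> M \<Longrightarrow> h = h'"
  shows "\<exists>h\<in>hospitals I. residents_of M h = {}"
proof (rule ccontr)
  assume "\<not> ?thesis"
  then have "\<forall>h\<in>hospitals I. \<exists>r. (r, h) \<in> M" by (auto simp: residents_of_def)
  then obtain f where f: "\<forall>h\<in>hospitals I. (f h, h) \<in> M" by metis
  have "inj_on f (hospitals I)" using f assms(3) by (metis inj_onI)
  moreover have "f ` hospitals I \<subseteq> residents I" using f assms(2) by auto
  ultimately have "card (hospitals I) \<le> card (residents I)"
    by (meson card_inj_on_le finite_lessThan)
  then show False using marriage_nres_less[OF assms(1)] by simp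
qed

lemma stable_matching_matched:
  assumes "I \<in> marriage" "stable_matching I M" "r \<in> residents I"
  shows "\<exists>h\<in>hospitals I. (r, h) \<in> M"
proof (rule ccontr)
  assume a: "\<not> ?thesis"
  have m: "matching I M" using assms by (simp add: stable_matching_def)
  then have sub: "M \<subseteq> residents I \<times> hospitals I" by (simp add: matching_def)
  then have "unmatched M r" using a by (auto simp: unmatched_def hospitals_of_def)
  moreover obtain h where "h \<in> hospitals I" "residents_of M h = {}"
    using marriage_unfilled_hospital[OF assms(1) sub] matching_right_unique[OF m] by blast
  ultimately have "blocks I M r h" "h \<in> hospitals I"
    using marriage_uq[OF assms(1)] by (auto simp: blocks_def)
  then show False using assms by (auto simp: stable_matching_def)
qed

text \<open>An empty hospital has room, so strictly preferring it to \<open>h\<close> would block.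
  The counting argument uses stability of both matchings in this form.\<close>

lemma stable_matching_no_envy_of_empty:
  assumes "I \<in> marriage" "stable_matching I M" "(r, h) \<in> M" "h' \<in> hospitals I"
    and "residents_of M h' = {}"
  shows "(h, h') \<in> rpref I r"
proof (rule ccontr)
  assume a: "(h, h') \<notin> rpref I r"
  have m: "matching I M" using assms by (simp add: stable_matching_def)
  then have rh: "r \<in> residents I" "h \<in> hospitals I" using assms(3) by (auto simp: matching_def)
  then have "strictly_prefers (rpref I r) h' (hospital_of M r)"
    using a pref_list_total[OF marriage_rpref[OF assms(1) rh(1)] assms(4) rh(2)]
    by (auto simp: strictly_prefers_def hospital_of_eq[OF m assms(3)])
  then have "blocks I M r h'"
    using assms(5) marriage_uq[OF assms(1,4)] by (auto simp: blocks_def)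
  then show False using assms(2,4) rh by (auto simp: stable_matching_def)
qed

section \<open>Scores as cardinalities and the counting bound\<close>

definition satisfied :: "instance_data \<Rightarrow> assignment \<Rightarrow> nat set" where
  "satisfied I M = {h \<in> hospitals I. lq I h = 0 \<or> residents_of M h \<noteq> {}}"

lemma finite_satisfied [simp]: "finite (satisfied I M)"
  by (simp add: satisfied_def)

lemma marriage_score:
  assumes "I \<in> marriage" "matching I M"
  shows "score I M = real (card (satisfied I M))"
proof -
  have "hospital_score I M h = (if h \<in> satisfied I M then 1 else 0)" if h: "h \<in> hospitals I" for h
  proof -
    have "card (residents_of M h) \<le> 1"
      using assms h by (auto simp: matching_def marriage_uq)
    moreover have "finite (residents_of M h)"
      using assms finite_matching_sets by (auto simp: matching_def)
    ultimately have "residents_of M h = {} \<or> card (residents_of M h) = 1"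
      by (metis card_0_eq le_neq_implies_less less_one)
    then show ?thesis
      using marriage_lq[OF assms(1) h] h by (auto simp: hospital_score_def satisfied_def)
  qed
  then have "score I M = (\<Sum>h\<in>hospitals I. if h \<in> satisfied I M then 1 else 0)"
    unfolding score_def by (intro sum.cong) auto
  also have "\<dots> = real (card (hospitals I \<inter> satisfied I M))"
    by (simp add: sum.If_cases)
  also have "hospitals I \<inter> satisfied I M = satisfied I M"
    by (auto simp: satisfied_def)
  finally show ?thesis .
qed

lemma finite_stable_matchings: "finite {M. stable_matching I M}"
proof (rule finite_subset)
  show "{M. stable_matching I M} \<subseteq> Pow (residents I \<times> hospitals I)"
    by (auto simp: stable_matching_def matching_def)
qed simp

lemma OPT_ge: "stable_matching I M \<Longrightarrow> score I M \<le> OPT I"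
  unfolding OPT_def by (intro Max_ge) (auto simp: finite_stable_matchings)

lemma OPT_le:
  assumes "stable_matching I M" "\<And>N. stable_matching I N \<Longrightarrow> score I N \<le> b"
  shows "OPT I \<le> b"
  unfolding OPT_def using assms by (subst Max_le_iff) (auto simp: finite_stable_matchings)

text \<open>The hypothesis rules out the paths with a single resident.\<close>

lemma score_le_three_halves:
  assumes I: "I \<in> marriage" and M: "stable_matching I M" and N: "stable_matching I N"
    and tie: "\<And>r h h'. (r, h) \<in> M \<Longrightarrow> lq I h = 0 \<Longrightarrow> h' \<in> hospitals I \<Longrightarrow> lq I h' = 1 \<Longrightarrow>
      (h, h') \<in> rpref I r \<Longrightarrow> (h', h) \<in> rpref I r \<Longrightarrow> residents_of M h' \<noteq> {}"
  shows "score I N \<le> 3 / 2 * score I M"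
proof -
  have mM: "matching I M" and mN: "matching I N"
    using M N by (auto simp: stable_matching_def)
  have "\<forall>r\<in>residents I. \<exists>h\<in>hospitals I. (r, h) \<in> M"
    using stable_matching_matched[OF I M] by blast
  then obtain f where f: "\<And>r. r \<in> residents I \<Longrightarrow> f r \<in> hospitals I \<and> (r, f r) \<in> M" by metis
  have "\<forall>r\<in>residents I. \<exists>h\<in>hospitals I. (r, h) \<in> N"
    using stable_matching_matched[OF I N] by blast
  then obtain g where g: "\<And>r. r \<in> residents I \<Longrightarrow> g r \<in> hospitals I \<and> (r, g r) \<in> N" by metis
  have inj_f: "inj_on f (residents I)" and inj_g: "inj_on g (residents I)"
    using f g marriage_left_unique[OF I mM] marriage_left_unique[OF I mN] by (metis inj_onI)+
  have N_eq: "(r, h) \<in> N \<longleftrightarrow> r \<in> residents I \<and> h = g r" for r h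
    using g mN matching_right_unique[OF mN] by (auto simp: matching_def)
  have M_eq: "(r, h) \<in> M \<longleftrightarrow> r \<in> residents I \<and> h = f r" for r h
    using f mM matching_right_unique[OF mM] by (auto simp: matching_def)
  \<comment> \<open>\<open>D\<close> holds the gains of \<open>N\<close> and \<open>E\<close> its
    losses; \<open>A\<close> indexes the gains by the residents that \<open>N\<close> places
    there.\<close>
  define D where "D = satisfied I N - satisfied I M"
  define E where "E = satisfied I M - satisfied I N"
  define A where "A = {r \<in> residents I. g r \<in> D}"
  have A_sub: "A \<subseteq> residents I" by (auto simp: A_def)
  \<comment> \<open>A gain is unsatisfied in \<open>M\<close>, so its lower quota is not 0 and
    \<open>N\<close> must fill it.\<close>
  have gA: "g ` A = D"
    by (auto simp: A_def D_def satisfied_def residents_of_def N_eq)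
  \<comment> \<open>One step along the path, from the gain \<open>g r\<close> over \<open>r\<close>
    to \<open>f r\<close>.\<close>
  have "f ` A \<subseteq> g ` (residents I - A) \<union> E"
  proof
    fix h assume "h \<in> f ` A"
    then obtain r where r: "r \<in> residents I" "g r \<in> D" "h = f r" by (auto simp: A_def)
    have gr: "residents_of M (g r) = {}" "lq I (g r) = 1"
      using r marriage_lq[OF I, of "g r"] by (auto simp: D_def satisfied_def)
    show "h \<in> g ` (residents I - A) \<union> E"
    proof (cases "residents_of N h = {}")
      case True
      \<comment> \<open>The path would end here after one resident. Stability of both matchings
        makes \<open>r\<close> indifferent, since \<open>g r\<close> is empty in \<open>M\<close>
        and \<open>f r\<close> is empty in \<open>N\<close>; \<open>tie\<close> then leaves only
        lower quota 1 for \<open>f r\<close>, which makes it a loss.\<close>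
      have "(f r, g r) \<in> rpref I r"
        using stable_matching_no_envy_of_empty[OF I M _ _ gr(1)] f[OF r(1)] g[OF r(1)] by blast
      moreover have "(g r, f r) \<in> rpref I r"
        using stable_matching_no_envy_of_empty[OF I N] True f[OF r(1)] g[OF r(1)] r(3) by blast
      ultimately have "lq I (f r) \<noteq> 0"
        using tie[of r "f r" "g r"] f[OF r(1)] g[OF r(1)] gr by blast
      then have "h \<in> E"
        using True r f[OF r(1)] by (auto simp: E_def satisfied_def residents_of_def)
      then show ?thesis by simp
    next
      case False
      then obtain r' where r': "r' \<in> residents I" "h = g r'"
        by (auto simp: residents_of_def N_eq)
      have "h \<in> satisfied I M" using r f[OF r(1)] by (auto simp: satisfied_def residents_of_def)
      then have "r' \<notin> A" using r' by (auto simp: A_def D_def)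
      then show ?thesis using r' by auto
    qed
  qed
  then have "card (f ` A) \<le> card (g ` (residents I - A) \<union> E)"
    by (intro card_mono) (auto simp: E_def)
  also have "\<dots> \<le> card (g ` (residents I - A)) + card E" by (rule card_Un_le)
  also have "card (g ` (residents I - A)) = nres I - card A"
    using inj_on_subset[OF inj_g, of "residents I - A"] A_sub
    by (subst card_image) (auto simp: card_Diff_subset finite_subset)
  also have "card (f ` A) = card A"
    using inj_on_subset[OF inj_f A_sub] by (rule card_image)
  finally have 1: "card A \<le> nres I - card A + card E" .
  have "card A \<le> nres I" using card_mono[OF _ A_sub] by simp
  with 1 have 2: "2 * card A \<le> nres I + card E" by simp
  have 3: "card A = card D" using inj_on_subset[OF inj_g A_sub] gA card_image by metis
  have "f ` residents I \<subseteq> satisfied I M"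
    using f by (auto simp: satisfied_def residents_of_def)
  then have "card (f ` residents I) \<le> card (satisfied I M)" by (intro card_mono) auto
  then have 4: "nres I \<le> card (satisfied I M)" using card_image[OF inj_f] by simp
  \<comment> \<open>The scores differ by |D| - |E|. Doubling this and using 2|D| \<le> n + |E| and n
    \<le> \<open>card (satisfied I M)\<close> gives the factor.\<close>
  have "card (satisfied I N) = card (satisfied I N \<inter> satisfied I M) + card D"
    unfolding D_def by (metis card_Int_Diff finite_satisfied)
  moreover have "card (satisfied I M) = card (satisfied I N \<inter> satisfied I M) + card E"
    unfolding E_def by (metis card_Int_Diff finite_satisfied Int_commute)
  ultimately have "2 * card (satisfied I N) \<le> 3 * card (satisfied I M)"
    using 2 3 4 by linarith
  then have "2 * real (card (satisfied I N)) \<le> 3 * real (card (satisfied I M))" by linarith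
  then show ?thesis by (simp add: marriage_score I mM mN)
qed

subsection \<open>Double Proposal\<close>

text \<open>Bare sets instead of a state let one step of the algorithm be split into smaller updates
  whose intermediate tuples need not be reachable. In \<open>deleted_full\<close> the occupant must
  itself have been rejected before: rule (2) ejects only someone not rejected so far, so such an
  occupant yields only by rule (4), to someone the hospital ranks at least as high.\<close>

locale dp_invariant =
  fixes I :: instance_data and M P R D :: "(nat \<times> nat) set"
  assumes marriage: "I \<in> marriage"
    and assigned_proposed: "M \<subseteq> P"
    and proposed_sub: "P \<subseteq> residents I \<times> hospitals I"
    and rejected_sub: "R \<subseteq> P"
    and deleted_sub: "D \<subseteq> R"
    and right_unique: "\<And>r h h'. (r, h) \<in> M \<Longrightarrow> (r, h') \<in> M \<Longrightarrow> h = h'"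
    and left_unique: "\<And>r r' h. (r, h) \<in> M \<Longrightarrow> (r', h) \<in> M \<Longrightarrow> r = r'"
    and not_deleted: "\<And>r h. (r, h) \<in> M \<Longrightarrow> (r, h) \<notin> D"
    and assigned_top: "\<And>r h h'. (r, h) \<in> M \<Longrightarrow> h' \<in> hospitals I \<Longrightarrow> (r, h') \<notin> D \<Longrightarrow>
      (h, h') \<in> rpref I r"
    and deleted_full: "\<And>r h. (r, h) \<in> D \<Longrightarrow>
      \<exists>x. (x, h) \<in> M \<and> (x, h) \<in> R \<and> (x, r) \<in> hpref I h"
    and zero_quota_rejected: "\<And>r h. (r, h) \<in> M \<Longrightarrow> lq I h = 0 \<Longrightarrow> (r, h) \<in> R"
    and zero_quota_proposed: "\<And>r h h'. (r, h) \<in> M \<Longrightarrow> lq I h = 0 \<Longrightarrow> h' \<in> hospitals I \<Longrightarrow>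
      (h, h') \<in> rpref I r \<Longrightarrow> (h', h) \<in> rpref I r \<Longrightarrow> (r, h') \<in> P"
    and proposed_filled: "\<And>r h. (r, h) \<in> P \<Longrightarrow> lq I h \<noteq> 0 \<Longrightarrow> \<exists>x. (x, h) \<in> M"

lemma (in dp_invariant) assigned_sub: "M \<subseteq> residents I \<times> hospitals I"
  using assigned_proposed proposed_sub by blast

text \<open>\<open>repeated\<close> is the priority of untried hospitals in logical form:
  \<open>r\<close> returns to a hospital only after trying everything listed in the top tie.\<close>

locale dp_proposal = dp_invariant +
  fixes r h :: nat
  assumes proposer: "r \<in> residents I" "\<And>h. (r, h) \<notin> M"
    and target: "h \<in> hospitals I" "(r, h) \<notin> D"
    and target_top: "\<And>h'. h' \<in> hospitals I \<Longrightarrow> (r, h') \<notin> D \<Longrightarrow> (h, h') \<in> rpref I r"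
    and repeated: "\<And>h'. (r, h) \<in> P \<Longrightarrow> h' \<in> hospitals I \<Longrightarrow> (r, h') \<notin> D \<Longrightarrow>
      (h', h) \<in> rpref I r \<Longrightarrow> (r, h') \<in> P"
begin

text \<open>Covers rules (1) and (3). With lower quota 0 acceptance is by rule (3), so
  \<open>r\<close> has been rejected by \<open>h\<close> before.\<close>

lemma accept_empty:
  assumes "residents_of M h = {}" "lq I h = 0 \<Longrightarrow> (r, h) \<in> R"
  shows "dp_invariant I (insert (r, h) M) (insert (r, h) P) R D"
proof unfold_locales
  have e: "(x, h) \<notin> M" for x using assms(1) by (auto simp: residents_of_def)
  \<comment> \<open>A past rejection implies a past proposal to \<open>h\<close>, so
    \<open>repeated\<close> covers the hospitals still listed; deleted ones were proposed to before
    their deletion.\<close>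
  have t: "(r, h2) \<in> P" if "lq I h = 0" "h2 \<in> hospitals I" "(h2, h) \<in> rpref I r" for h2
  proof (cases "(r, h2) \<in> D")
    case False
    have "(r, h) \<in> P" using assms(2) that(1) rejected_sub by blast
    then show ?thesis using repeated False that by simp
  qed (use deleted_sub rejected_sub in blast)
  fix r1 r2 h1 h2
  show "(r1, h2) \<in> insert (r, h) P"
    if "(r1, h1) \<in> insert (r, h) M" "lq I h1 = 0" "h2 \<in> hospitals I"
      "(h1, h2) \<in> rpref I r1" "(h2, h1) \<in> rpref I r1"
    using that zero_quota_proposed[of r1 h1 h2] t[of h2] by auto
  show "(h1, h2) \<in> rpref I r1"
    if "(r1, h1) \<in> insert (r, h) M" "h2 \<in> hospitals I" "(r1, h2) \<notin> D"
    using that assigned_top[of r1 h1 h2] target_top[of h2] by auto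
  show "\<exists>x. (x, h1) \<in> insert (r, h) M \<and> (x, h1) \<in> R \<and> (x, r1) \<in> hpref I h1"
    if "(r1, h1) \<in> D"
    using deleted_full[OF that] by auto
  show "\<exists>x. (x, h1) \<in> insert (r, h) M" if "(r1, h1) \<in> insert (r, h) P" "lq I h1 \<noteq> 0"
    using that proposed_filled[of r1 h1] by auto
  show "(r1, h1) \<in> R" if "(r1, h1) \<in> insert (r, h) M" "lq I h1 = 0"
    using that zero_quota_rejected[of r1 h1] assms(2) by auto
  show "r1 = r2" if "(r1, h1) \<in> insert (r, h) M" "(r2, h1) \<in> insert (r, h) M"
    using that left_unique[of r1 h1 r2] e by auto
  show "h1 = h2" if "(r1, h1) \<in> insert (r, h) M" "(r1, h2) \<in> insert (r, h) M"
    using that right_unique[of r1 h1 h2] proposer(2) by auto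
  show "(r1, h1) \<notin> D" if "(r1, h1) \<in> insert (r, h) M"
    using that not_deleted[of r1 h1] target(2) by auto
  show "insert (r, h) M \<subseteq> insert (r, h) P" using assigned_proposed by blast
  show "insert (r, h) P \<subseteq> residents I \<times> hospitals I"
    using proposed_sub proposer(1) target(1) by blast
  show "R \<subseteq> insert (r, h) P" using rejected_sub by blast
qed (fact marriage deleted_sub)+

text \<open>Serves rules (2) and (4) together. The last hypothesis is vacuous in rule (2), where the
  ejected \<open>x\<close> had not been rejected; in rule (4) both residents had been rejected and
  \<open>x\<close> is a worst one.\<close>

lemma replace_occupant:
  assumes "(x, h) \<in> M" "lq I h = 0 \<Longrightarrow> (r, h) \<in> R"
    and "(x, h) \<in> R \<Longrightarrow> (r, h) \<in> R \<and> (r, x) \<in> hpref I h"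
  shows "dp_invariant I (insert (r, h) M - {(x, h)}) (insert (r, h) P) R D"
proof unfold_locales
  have xr: "x \<noteq> r" using assms(1) proposer(2) by auto
  have e: "(y, h) \<in> M \<Longrightarrow> y = x" for y using assms(1) left_unique by auto
  have t: "(r, h2) \<in> P" if "lq I h = 0" "h2 \<in> hospitals I" "(h2, h) \<in> rpref I r" for h2
  proof (cases "(r, h2) \<in> D")
    case False
    have "(r, h) \<in> P" using assms(2) that(1) rejected_sub by blast
    then show ?thesis using repeated False that by simp
  qed (use deleted_sub rejected_sub in blast)
  let ?M = "insert (r, h) M - {(x, h)}"
  fix r1 r2 h1 h2
  show "(r1, h2) \<in> insert (r, h) P"
    if "(r1, h1) \<in> ?M" "lq I h1 = 0" "h2 \<in> hospitals I"
      "(h1, h2) \<in> rpref I r1" "(h2, h1) \<in> rpref I r1"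
    using that zero_quota_proposed[of r1 h1 h2] t[of h2] by auto
  show "(h1, h2) \<in> rpref I r1"
    if "(r1, h1) \<in> ?M" "h2 \<in> hospitals I" "(r1, h2) \<notin> D"
    using that assigned_top[of r1 h1 h2] target_top[of h2] by auto
  show "\<exists>y. (y, h1) \<in> ?M \<and> (y, h1) \<in> R \<and> (y, r1) \<in> hpref I h1" if d: "(r1, h1) \<in> D"
  proof (cases "h1 = h")
    case True
    then have "(x, h) \<in> R" "(x, r1) \<in> hpref I h" using deleted_full[OF d] e by auto
    \<comment> \<open>The role of certifying occupant passes from \<open>x\<close> to
      \<open>r\<close> by transitivity.\<close>
    then have "(r, h) \<in> R" "(r, r1) \<in> hpref I h"
      using assms(3) pref_list_trans[OF marriage_hpref[OF marriage target(1)], of r x r1] by auto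
    then show ?thesis using True xr by auto
  next
    case False
    then show ?thesis using deleted_full[OF d] by auto
  qed
  show "\<exists>y. (y, h1) \<in> ?M" if "(r1, h1) \<in> insert (r, h) P" "lq I h1 \<noteq> 0"
    using that proposed_filled[of r1 h1] xr by (cases "h1 = h") auto
  show "(r1, h1) \<in> R" if "(r1, h1) \<in> ?M" "lq I h1 = 0"
    using that zero_quota_rejected[of r1 h1] assms(2) by auto
  show "r1 = r2" if "(r1, h1) \<in> ?M" "(r2, h1) \<in> ?M"
    using that left_unique[of r1 h1 r2] e by auto
  show "h1 = h2" if "(r1, h1) \<in> ?M" "(r1, h2) \<in> ?M"
    using that right_unique[of r1 h1 h2] proposer(2) by auto
  show "(r1, h1) \<notin> D" if "(r1, h1) \<in> ?M"
    using that not_deleted[of r1 h1] target(2) by auto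
  show "?M \<subseteq> insert (r, h) P" using assigned_proposed by blast
  show "insert (r, h) P \<subseteq> residents I \<times> hospitals I"
    using proposed_sub proposer(1) target(1) by blast
  show "R \<subseteq> insert (r, h) P" using rejected_sub by blast
qed (fact marriage deleted_sub)+

end

context dp_invariant
begin

text \<open>For steps that reject the proposer itself: the assignment stays, and the clause at risk
  is \<open>proposed_filled\<close>.\<close>

lemma record_proposal:
  assumes "r \<in> residents I" "h \<in> hospitals I" "lq I h \<noteq> 0 \<Longrightarrow> \<exists>x. (x, h) \<in> M"
  shows "dp_invariant I M (insert (r, h) P) R D"
proof unfold_locales
  fix r1 h1 h2
  show "(r1, h2) \<in> insert (r, h) P"
    if "(r1, h1) \<in> M" "lq I h1 = 0" "h2 \<in> hospitals I"
      "(h1, h2) \<in> rpref I r1" "(h2, h1) \<in> rpref I r1"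
    using zero_quota_proposed[OF that] by simp
  show "\<exists>x. (x, h1) \<in> M" if "(r1, h1) \<in> insert (r, h) P" "lq I h1 \<noteq> 0"
    using that proposed_filled[of r1 h1] assms(3) by auto
  show "insert (r, h) P \<subseteq> residents I \<times> hospitals I" using proposed_sub assms(1,2) by blast
  show "M \<subseteq> insert (r, h) P" "R \<subseteq> insert (r, h) P" using assigned_proposed rejected_sub by blast+
qed (fact marriage deleted_sub right_unique left_unique not_deleted assigned_top deleted_full
      zero_quota_rejected)+

lemma record_rejection:
  assumes "(r, h) \<in> P"
  shows "dp_invariant I M P (insert (r, h) R) D"
proof unfold_locales
  fix r1 h1
  show "\<exists>x. (x, h1) \<in> M \<and> (x, h1) \<in> insert (r, h) R \<and> (x, r1) \<in> hpref I h1" if "(r1, h1) \<in> D"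
    using deleted_full[OF that] by auto
  show "(r1, h1) \<in> insert (r, h) R" if "(r1, h1) \<in> M" "lq I h1 = 0"
    using zero_quota_rejected[OF that] by simp
  show "insert (r, h) R \<subseteq> P" "D \<subseteq> insert (r, h) R" using rejected_sub deleted_sub assms by blast+
qed (fact marriage assigned_proposed proposed_sub right_unique left_unique not_deleted
      assigned_top zero_quota_proposed proposed_filled)+

lemma record_deletion:
  assumes "(r, h) \<in> R" "(r, h) \<notin> M" "(x, h) \<in> M" "(x, h) \<in> R" "(x, r) \<in> hpref I h"
  shows "dp_invariant I M P R (insert (r, h) D)"
proof unfold_locales
  fix r1 h1 h2
  show "\<exists>x. (x, h1) \<in> M \<and> (x, h1) \<in> R \<and> (x, r1) \<in> hpref I h1" if "(r1, h1) \<in> insert (r, h) D"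
    using that deleted_full[of r1 h1] assms by auto
  show "(r1, h1) \<notin> insert (r, h) D" if "(r1, h1) \<in> M"
    using not_deleted[OF that] that assms(2) by auto
  show "(h1, h2) \<in> rpref I r1"
    if "(r1, h1) \<in> M" "h2 \<in> hospitals I" "(r1, h2) \<notin> insert (r, h) D"
    using that assigned_top[of r1 h1 h2] by simp
  show "insert (r, h) D \<subseteq> R" using deleted_sub assms(1) by blast
qed (fact marriage assigned_proposed proposed_sub rejected_sub right_unique left_unique
      zero_quota_rejected zero_quota_proposed proposed_filled)+

lemma is_matching: "matching I M"
  by (rule marriage_matchingI[OF marriage assigned_sub]) (fact right_unique left_unique)+

lemma finite_sets: "finite M" "finite P" "finite R" "finite D"
proof -
  have "finite (residents I \<times> hospitals I)" by simp
  then show "finite M" "finite P" "finite R" "finite D"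
    using assigned_sub proposed_sub rejected_sub deleted_sub by (meson finite_subset)+
qed

text \<open>Each assigned hospital is top among those still listed, so a strictly better
  \<open>h\<close> must have been deleted. Its certified occupant is its only one and is ranked at
  least as high, so \<open>h\<close> has neither room nor a motive.\<close>

lemma stable_if_all_matched:
  assumes "\<And>r. r \<in> residents I \<Longrightarrow> \<not> unmatched M r"
  shows "stable_matching I M"
  unfolding stable_matching_def
proof (intro conjI notI)
  assume "\<exists>r\<in>residents I. \<exists>h\<in>hospitals I. blocks I M r h"
  then obtain r h where rh: "r \<in> residents I" "h \<in> hospitals I" "blocks I M r h" by auto
  then have "\<not> unmatched M r" using assms by auto
  then obtain h' where h': "(r, h') \<in> M" by (auto simp: unmatched_def hospitals_of_def)
  then have "strictly_prefers (rpref I r) h h'"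
    using rh \<open>\<not> unmatched M r\<close> hospital_of_eq[OF is_matching] by (auto simp: blocks_def)
  then have "(r, h) \<in> D"
    using assigned_top[OF h' rh(2)] by (auto simp: strictly_prefers_def)
  then obtain x where x: "(x, h) \<in> M" "(x, r) \<in> hpref I h" using deleted_full by blast
  then have "residents_of M h = {x}" using left_unique by (auto simp: residents_of_def)
  then show False
    using rh(3) x marriage_uq[OF marriage rh(2)] by (auto simp: blocks_def strictly_prefers_def)
qed (rule is_matching)

text \<open>Supplies the hypothesis \<open>tie\<close> of
  \<open>score_le_three_halves\<close>.\<close>

lemma tied_with_zero_quota_filled:
  assumes "(r, h) \<in> M" "lq I h = 0" "h' \<in> hospitals I" "lq I h' = 1"
    and "(h, h') \<in> rpref I r" "(h', h) \<in> rpref I r"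
  shows "residents_of M h' \<noteq> {}"
  using zero_quota_proposed[OF assms(1-3,5,6)] proposed_filled[of r h'] assms(4)
  by (auto simp: residents_of_def)

text \<open>A deleted hospital is filled, while some hospital is always empty; hence no list runs
  out and a proposal is always possible.\<close>

lemma list_nonempty: "\<exists>h\<in>hospitals I. (r, h) \<notin> D"
proof -
  have "\<exists>h\<in>hospitals I. residents_of M h = {}"
    by (rule marriage_unfilled_hospital[OF marriage assigned_sub]) (fact right_unique)
  then obtain h where "h \<in> hospitals I" "\<And>x. (x, h) \<notin> M" by (auto simp: residents_of_def)
  then show ?thesis using deleted_full[of r h] by blast
qed

end

section \<open>Termination, stability and the approximation guarantee\<close>

abbreviation dp_inv :: "instance_data \<Rightarrow> dp_state \<Rightarrow> bool" where
  "dp_inv I s \<equiv> dp_invariant I (asg s) (proposed s) (rejected s) (deleted s)"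

text \<open>The termination potential: acceptance by an empty hospital enlarges the assignment; rule
  (2) keeps its size and adds a rejection; rule (4) keeps both sizes and adds a deletion.\<close>

definition progress :: "dp_state \<Rightarrow> nat" where
  "progress s = card (asg s) + card (rejected s) + card (deleted s)"

lemma dp_inv_init: "I \<in> marriage \<Longrightarrow> dp_inv I dp_init"
  by unfold_locales (auto simp: dp_init_def)

lemma dp_inv_progress_le:
  assumes "dp_inv I s"
  shows "progress s \<le> 3 * card (residents I \<times> hospitals I)"
proof -
  interpret dp_invariant I "asg s" "proposed s" "rejected s" "deleted s" by fact
  have "rejected s \<subseteq> residents I \<times> hospitals I" "deleted s \<subseteq> residents I \<times> hospitals I"
    using proposed_sub rejected_sub deleted_sub by auto
  moreover have "card X \<le> card (residents I \<times> hospitals I)" if "X \<subseteq> residents I \<times> hospitals I"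
    for X using that by (intro card_mono) simp
  ultimately have "card (asg s) \<le> card (residents I \<times> hospitals I)"
    "card (rejected s) \<le> card (residents I \<times> hospitals I)"
    "card (deleted s) \<le> card (residents I \<times> hospitals I)"
    using assigned_sub by blast+
  then show ?thesis by (simp add: progress_def)
qed

lemma dp_proposal_target:
  assumes "dp_inv I s" "unmatched_residents I s \<noteq> {}"
  defines "r \<equiv> Min (unmatched_residents I s)"
  shows "dp_proposal I (asg s) (proposed s) (rejected s) (deleted s) r (proposal_target I s r)"
proof -
  interpret dp_invariant I "asg s" "proposed s" "rejected s" "deleted s" by fact
  have "finite (unmatched_residents I s)" by (simp add: unmatched_residents_def)
  then have "r \<in> unmatched_residents I s" unfolding r_def using assms(2) by (rule Min_in)
  then have r: "r \<in> residents I" "\<And>h. (r, h) \<notin> asg s"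
    by (auto simp: unmatched_residents_def unmatched_def hospitals_of_def)
  have "\<exists>h\<in>current_list I s r. \<forall>h'\<in>current_list I s r. (h, h') \<in> rpref I r"
    using list_nonempty[of r]
    by (intro finite_pref_list_has_top[OF marriage_rpref[OF marriage r(1)]])
       (auto simp: current_list_def)
  then have T: "top_tie I s r \<noteq> {}" by (auto simp: top_tie_def)
  let ?C = "proposal_candidates I s r"
  have C: "?C \<noteq> {}" "?C \<subseteq> top_tie I s r"
    using T by (auto simp: proposal_candidates_def Let_def)
  have fin: "finite (top_tie I s r)" by (auto simp: top_tie_def current_list_def)
  then have finC: "finite ?C" using C(2) finite_subset by blast
  define h where "h = proposal_target I s r"
  obtain y where "is_arg_min (lq I) (\<lambda>x. x \<in> ?C) y"
    using ex_is_arg_min_if_finite[OF finC C(1)] by blast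
  then have "y \<in> {h \<in> ?C. \<forall>h'\<in>?C. lq I h \<le> lq I h'}"
    by (auto simp: is_arg_min_linorder)
  then have "h \<in> {h \<in> ?C. \<forall>h'\<in>?C. lq I h \<le> lq I h'}"
    unfolding h_def proposal_target_def Let_def using finC by (intro Min_in) auto
  then have hC: "h \<in> ?C" by simp
  then have hT: "h \<in> top_tie I s r" using C(2) by auto
  show ?thesis
    unfolding h_def[symmetric]
  proof unfold_locales
    show "r \<in> residents I" "\<And>h. (r, h) \<notin> asg s" by fact+
    show "h \<in> hospitals I" "(r, h) \<notin> deleted s"
      using hT by (auto simp: top_tie_def current_list_def)
    fix h' assume h': "h' \<in> hospitals I" "(r, h') \<notin> deleted s"
    then show "(h, h') \<in> rpref I r"
      using hT by (auto simp: top_tie_def current_list_def)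
    assume "(r, h) \<in> proposed s" "(h', h) \<in> rpref I r"
    \<comment> \<open>A hospital tied with \<open>h\<close> is in the top tie as well. Were it
      untried, the candidates would be untried hospitals only, which excludes
      \<open>h\<close>.\<close>
    have "(h', h'') \<in> rpref I r" if "h'' \<in> current_list I s r" for h''
      using that hT pref_list_trans[OF marriage_rpref[OF marriage r(1)] \<open>(h', h) \<in> rpref I r\<close>]
      by (auto simp: top_tie_def)
    then have "h' \<in> top_tie I s r" using h' by (auto simp: top_tie_def current_list_def)
    then show "(r, h') \<in> proposed s"
      using hC \<open>(r, h) \<in> proposed s\<close>
      by (auto simp: proposal_candidates_def Let_def split: if_splits)
  qed
qed

text \<open>Evaluates a step from proposer, target, occupants and not yet rejected residents alone.
  Rules (1) and (3) act alike and are merged.\<close>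

lemma dp_step_eq:
  assumes "Min (unmatched_residents I s) = r" "proposal_target I s r = h"
    and "residents_of (asg s) h = Q" "{x \<in> insert r Q. (x, h) \<notin> rejected s} = F"
  shows "dp_step I s =
    (if card Q < lq I h \<or> F = {} \<and> card Q < uq I h then
       \<lparr>asg = insert (r, h) (asg s), proposed = insert (r, h) (proposed s),
        rejected = rejected s, deleted = deleted s\<rparr>
     else if F \<noteq> {} then
       \<lparr>asg = insert (r, h) (asg s) - {(Max F, h)}, proposed = insert (r, h) (proposed s),
        rejected = insert (Max F, h) (rejected s), deleted = deleted s\<rparr>
     else
       (let y = worst (hpref I h) (insert r Q) in
        \<lparr>asg = insert (r, h) (asg s) - {(y, h)}, proposed = insert (r, h) (proposed s),
         rejected = insert (y, h) (rejected s), deleted = insert (y, h) (deleted s)\<rparr>))"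
  unfolding dp_step_def Let_def assms by simp

lemma dp_step_progress:
  assumes inv: "dp_inv I s" and ne: "unmatched_residents I s \<noteq> {}"
  shows "dp_inv I (dp_step I s) \<and> progress s < progress (dp_step I s)"
proof -
  define r where "r = Min (unmatched_residents I s)"
  define h where "h = proposal_target I s r"
  obtain M P R D where s: "s = \<lparr>asg = M, proposed = P, rejected = R, deleted = D\<rparr>"
    by (cases s) auto
  interpret dp_proposal I M P R D r h
    using dp_proposal_target[OF inv ne] s by (simp add: r_def h_def)
  define X where "X = insert r (residents_of M h)"
  define F where "F = {x \<in> X. (x, h) \<notin> R}"
  define k where "k = card (residents_of M h)"
  have sel: "asg s = M" "proposed s = P" "rejected s = R" "deleted s = D" by (simp_all add: s)
  note step = dp_step_eq[of I s r h "residents_of M h" F, unfolded sel, folded k_def X_def,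
      OF r_def[symmetric] h_def[symmetric] refl F_def[symmetric], unfolded Let_def]
  have fin: "finite (residents_of M h)" "finite X" "finite F"
    using finite_matching_sets(3)[OF assigned_sub] by (auto simp: X_def F_def)
  have rM: "r \<notin> residents_of M h" using proposer(2) by (simp add: residents_of_def)
  have card_ins: "card (insert (r, h) M) = Suc (card M)"
    using proposer(2) finite_sets(1) by simp
  have lq01: "lq I h = 0 \<or> lq I h = 1" by (rule marriage_lq[OF marriage target(1)])
  consider (empty) "residents_of M h = {}" | (full) x where "residents_of M h = {x}"
  proof (cases "residents_of M h = {}")
    case False
    then obtain x where x: "(x, h) \<in> M" by (auto simp: residents_of_def)
    then have "residents_of M h = {x}"
      by (auto simp: residents_of_def dest: left_unique[OF _ x])
    then show ?thesis by (rule full)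
  qed (rule empty)
  then show ?thesis
  proof cases
    case empty
    then have k: "k = 0" by (simp add: k_def)
    show ?thesis
    proof (cases "lq I h \<noteq> 0 \<or> F = {}")
      case True
      then have "dp_step I s = \<lparr>asg = insert (r, h) M, proposed = insert (r, h) P,
          rejected = R, deleted = D\<rparr>"
        using k marriage_uq[OF marriage target(1)] by (auto simp: step)
      moreover have "dp_invariant I (insert (r, h) M) (insert (r, h) P) R D"
        using True by (intro accept_empty empty) (auto simp: F_def X_def)
      ultimately show ?thesis by (simp add: progress_def sel card_ins)
    next
      case False
      \<comment> \<open>A first proposal to an empty hospital of lower quota 0: rule (2) turns
        \<open>r\<close> away, and the new rejection is the progress.\<close>
      then have F: "F = {r}" "(r, h) \<notin> R" and l0: "lq I h = 0"
        using empty by (auto simp: F_def X_def)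
      then have "dp_step I s = \<lparr>asg = M, proposed = insert (r, h) P,
          rejected = insert (r, h) R, deleted = D\<rparr>"
        using k proposer(2) by (simp add: step)
      moreover have "dp_invariant I M (insert (r, h) P) (insert (r, h) R) D"
        using proposer target l0
        by (intro dp_invariant.record_rejection record_proposal) auto
      ultimately show ?thesis using F finite_sets by (simp add: progress_def sel)
    qed
  next
    case (full x)
    then have xM: "(x, h) \<in> M" and x_res: "x \<in> residents I" and xr: "x \<noteq> r"
      using assigned_sub rM by (auto simp: residents_of_def)
    have k: "k = 1" and X: "X = {r, x}" using full by (auto simp: k_def X_def)
    have swap: "insert (r, h) M - {(r, h)} = M" using proposer(2) by simp
    have card_swap: "card (insert (r, h) M - {(y, h)}) = card M" if "y \<in> X" for y
      using that X xM card_ins finite_sets by (subst card_Diff_singleton) auto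
    show ?thesis
    proof (cases "F = {}")
      case False
      then have mF: "Max F \<in> F" using fin by (intro Max_in)
      define y where "y = Max F"
      have y: "y \<in> X" "(y, h) \<notin> R" using mF by (auto simp: y_def F_def)
      have "dp_step I s = \<lparr>asg = insert (r, h) M - {(y, h)}, proposed = insert (r, h) P,
          rejected = insert (y, h) R, deleted = D\<rparr>"
        using k lq01 False by (auto simp: step y_def)
      moreover have "dp_invariant I (insert (r, h) M - {(y, h)}) (insert (r, h) P)
          (insert (y, h) R) D"
      proof (cases "y = r")
        case True
        then show ?thesis
          using proposer target xM
          by (simp add: swap) (intro dp_invariant.record_rejection record_proposal, auto)
      next
        case False
        then have yx: "y = x" using y X by auto
        have "dp_invariant I (insert (r, h) M - {(y, h)}) (insert (r, h) P) R D"
          unfolding yx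
        proof (rule replace_occupant[OF xM])
          \<comment> \<open>With lower quota 0 this case is contradictory: the occupant would have
            been rejected before, against the choice of \<open>y\<close>.\<close>
          show "(r, h) \<in> R" if "lq I h = 0" using zero_quota_rejected[OF xM that] y yx by auto
        qed (use y yx in auto)
        then show ?thesis
          using yx xM assigned_proposed by (intro dp_invariant.record_rejection) auto
      qed
      ultimately show ?thesis
        using y card_swap finite_sets by (simp add: progress_def sel)
    next
      case True
      define y where "y = worst (hpref I h) X"
      have R: "(r, h) \<in> R" "(x, h) \<in> R" using True X by (auto simp: F_def)
      have y: "y \<in> X" "\<forall>z\<in>X. (z, y) \<in> hpref I h"
        using worst_in[OF marriage_hpref[OF marriage target(1)] fin(2)] X x_res proposer
        by (auto simp: y_def)
      have yR: "(y, h) \<in> R" using R y X by auto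
      \<comment> \<open>In rule (4) the rejection is already on record, so the progress has to come
        from a new deletion.\<close>
      have yD: "(y, h) \<notin> D" using y X not_deleted[OF xM] target by auto
      have "dp_step I s = \<lparr>asg = insert (r, h) M - {(y, h)}, proposed = insert (r, h) P,
          rejected = R, deleted = insert (y, h) D\<rparr>"
        using k lq01 True marriage_uq[OF marriage target(1)] insert_absorb[OF yR]
        by (auto simp: step y_def)
      moreover have "dp_invariant I (insert (r, h) M - {(y, h)}) (insert (r, h) P) R
          (insert (y, h) D)"
      proof (cases "y = r")
        case True
        have "dp_invariant I M (insert (r, h) P) R D"
          using proposer target xM by (intro record_proposal) auto
        then show ?thesis
          unfolding True swap
          using R xM y X True proposer
          by (intro dp_invariant.record_deletion[of _ _ _ _ _ _ _ x]) auto
      next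
        case False
        then have yx: "y = x" using y X by auto
        have "dp_invariant I (insert (r, h) M - {(y, h)}) (insert (r, h) P) R D"
          unfolding yx using R y yx X by (intro replace_occupant xM) auto
        then show ?thesis
          using R y yx xr X by (intro dp_invariant.record_deletion[of _ _ _ _ _ _ _ r]) auto
      qed
      ultimately show ?thesis
        using y yD card_swap finite_sets by (simp add: progress_def sel)
    qed
  qed
qed

lemma double_proposal_reaches_end:
  assumes "I \<in> marriage"
  shows "\<exists>s. double_proposal I = asg s \<and> dp_inv I s \<and> unmatched_residents I s = {}"
proof -
  let ?B = "3 * card (residents I \<times> hospitals I)"
  let ?s = "while (\<lambda>s. unmatched_residents I s \<noteq> {}) (dp_step I) dp_init"
  have "dp_inv I ?s \<and> unmatched_residents I ?s = {}"
  proof (rule while_rule[where P = "dp_inv I"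
        and Q = "\<lambda>s. dp_inv I s \<and> unmatched_residents I s = {}"
        and r = "measure (\<lambda>s. ?B - progress s)"])
    fix s assume s: "dp_inv I s" "unmatched_residents I s \<noteq> {}"
    then have step: "dp_inv I (dp_step I s)" "progress s < progress (dp_step I s)"
      using dp_step_progress by auto
    show "dp_inv I (dp_step I s)" by (fact step)
    have "progress (dp_step I s) \<le> ?B" by (rule dp_inv_progress_le[OF step(1)])
    then show "(dp_step I s, s) \<in> measure (\<lambda>s. ?B - progress s)" using step(2) by simp
  qed (simp_all add: dp_inv_init[OF assms])
  then show ?thesis unfolding double_proposal_def by blast
qed

lemma
  assumes "I \<in> marriage"
  shows double_proposal_stable: "stable_matching I (double_proposal I)"
    and OPT_le_ALG: "OPT I \<le> 3 / 2 * ALG I"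
    and ALG_pos: "0 < ALG I"
proof -
  obtain s where s: "double_proposal I = asg s" "dp_inv I s" "unmatched_residents I s = {}"
    using double_proposal_reaches_end[OF assms] by blast
  interpret dp_invariant I "asg s" "proposed s" "rejected s" "deleted s" by (fact s(2))
  have all: "\<not> unmatched (asg s) r" if "r \<in> residents I" for r
    using s(3) that by (auto simp: unmatched_residents_def)
  then show st: "stable_matching I (double_proposal I)"
    unfolding s(1) by (rule stable_if_all_matched)
  show "OPT I \<le> 3 / 2 * ALG I"
  proof (rule OPT_le[OF st])
    fix N assume N: "stable_matching I N"
    show "score I N \<le> 3 / 2 * ALG I"
      unfolding ALG_def s(1)
      by (rule score_le_three_halves[OF assms st[unfolded s(1)] N])
        (rule tied_with_zero_quota_filled)
  qed
  obtain h where h: "h \<in> hospitals I" "(0, h) \<in> asg s"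
    using stable_matching_matched[OF assms st, of 0] marriage_nres_pos[OF assms] s(1) by auto
  then have "satisfied I (asg s) \<noteq> {}" by (auto simp: satisfied_def residents_of_def)
  then show "0 < ALG I"
    by (simp add: ALG_def s(1) marriage_score[OF assms is_matching] card_gt_0_iff)
qed

subsection \<open>Instances with two residents and three hospitals\<close>

definition rank_pref :: "nat set \<Rightarrow> (nat \<Rightarrow> nat) \<Rightarrow> nat rel" where
  "rank_pref A f = {(x, y). x \<in> A \<and> y \<in> A \<and> f x \<le> f y}"

lemma pref_list_rank_pref: "pref_list A (rank_pref A f)"
  by (auto simp: pref_list_def preorder_on_def rank_pref_def refl_on_def trans_def total_on_def)

text \<open>Smaller rank is better and equal ranks are ties. Hospitals are indifferent, so stability
  depends only on the residents' lists; hospital 2 alone has lower quota 0.\<close>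

definition two_residents :: "(nat \<Rightarrow> nat) \<Rightarrow> (nat \<Rightarrow> nat) \<Rightarrow> instance_data" where
  "two_residents f g =
     \<lparr>nres = 2, nhosp = 3,
      rpref = (\<lambda>r. rank_pref {..<3} (if r = 0 then f else if r = 1 then g else (\<lambda>_. 0))),
      hpref = (\<lambda>_. rank_pref {..<2} (\<lambda>_. 0)), lq = (\<lambda>h. if h = 2 then 0 else 1),
      uq = (\<lambda>_. 1)\<rparr>"

lemma two_residents_sel [simp]:
  "nres (two_residents f g) = 2" "nhosp (two_residents f g) = 3"
  "rpref (two_residents f g) 0 = rank_pref {..<3} f"
  "rpref (two_residents f g) 1 = rank_pref {..<3} g"
  "rpref (two_residents f g) (Suc 0) = rank_pref {..<3} g"
  "hpref (two_residents f g) h = rank_pref {..<2} (\<lambda>_. 0)"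
  "lq (two_residents f g) h = (if h = 2 then 0 else 1)"
  "uq (two_residents f g) h = 1"
  by (simp_all add: two_residents_def)

lemma two_residents_marriage: "two_residents f g \<in> marriage"
  by (auto simp: marriage_def hrt_mslq_def two_residents_def pref_list_rank_pref)

lemma less_2_iff: "(r :: nat) < 2 \<longleftrightarrow> r = 0 \<or> r = 1"
  by auto

lemma less_3_iff: "(h :: nat) < 3 \<longleftrightarrow> h = 0 \<or> h = 1 \<or> h = 2"
  by auto

lemma two_residents_matching:
  assumes "a \<noteq> b" "a < 3" "b < 3"
  shows "matching (two_residents f g) {(0, a), (1, b)}"
  by (rule marriage_matchingI[OF two_residents_marriage]) (use assms in auto)

text \<open>Indifferent hospitals never exchange an occupant, so only the one hospital left empty
  can block.\<close>

lemma two_residents_stable: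
  "stable_matching (two_residents f g) {(0, a), (1, b)} \<longleftrightarrow>
    a \<noteq> b \<and> a < 3 \<and> b < 3 \<and> (\<forall>h<3. h \<noteq> a \<longrightarrow> h \<noteq> b \<longrightarrow> f a \<le> f h \<and> g b \<le> g h)"
    (is "stable_matching ?I ?M \<longleftrightarrow> ?R")
proof
  assume st: "stable_matching ?I ?M"
  then have m: "matching ?I ?M" by (simp add: stable_matching_def)
  have ab: "a < 3" "b < 3" using m by (auto simp: matching_def)
  have ne: "a \<noteq> b" using marriage_left_unique[OF two_residents_marriage m, of 0 a 1] by auto
  have "f a \<le> f h \<and> g b \<le> g h" if "h < 3" "h \<noteq> a" "h \<noteq> b" for h
  proof -
    have "residents_of ?M h = {}" using that by (auto simp: residents_of_def)
    then have "(a, h) \<in> rpref ?I 0" "(b, h) \<in> rpref ?I 1"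
      using that(1)
      by (intro stable_matching_no_envy_of_empty[OF two_residents_marriage st]; simp)+
    then show ?thesis by (simp add: rank_pref_def)
  qed
  then show ?R using ab ne by blast
next
  assume R: ?R
  then have m: "matching ?I ?M" by (intro two_residents_matching) auto
  have "\<not> blocks ?I ?M r h" if "r < 2" "h < 3" for r h
  proof
    assume b: "blocks ?I ?M r h"
    have "r = 0 \<or> r = 1" using that by auto
    then have "\<not> unmatched ?M r" by (auto simp: unmatched_def hospitals_of_def)
    then have str: "strictly_prefers (rpref ?I r) h (hospital_of ?M r)"
      using b by (simp add: blocks_def)
    have "residents_of ?M h = {}"
    proof (rule ccontr)
      assume "residents_of ?M h \<noteq> {}"
      moreover have "finite (residents_of ?M h)"
        using m finite_matching_sets(3)[of ?M ?I h] by (simp add: matching_def)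
      ultimately have "\<not> card (residents_of ?M h) < 1" by simp
      then have "\<exists>r'\<in>residents_of ?M h. strictly_prefers (hpref ?I h) r r'"
        using b by (simp add: blocks_def)
      then show False using that(1)
        by (auto simp: strictly_prefers_def rank_pref_def residents_of_def)
    qed
    then have "h \<noteq> a" "h \<noteq> b" by (auto simp: residents_of_def)
    then have "f a \<le> f h" "g b \<le> g h" using R that by auto
    moreover have "hospital_of ?M 0 = a" "hospital_of ?M 1 = b"
      using hospital_of_eq[OF m] by auto
    ultimately show False
      using str \<open>r = 0 \<or> r = 1\<close> that R by (auto simp: strictly_prefers_def rank_pref_def)
  qed
  then show "stable_matching ?I ?M" using m by (auto simp: stable_matching_def)
qed

lemma two_residents_stable_cases:
  assumes "stable_matching (two_residents f g) M"
  obtains a b where "M = {(0, a), (1, b)}" "a \<noteq> b" "a < 3" "b < 3"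
    "\<And>h. h < 3 \<Longrightarrow> h \<noteq> a \<Longrightarrow> h \<noteq> b \<Longrightarrow> f a \<le> f h \<and> g b \<le> g h"
    "hospital_of M 0 = a" "hospital_of M 1 = b"
proof -
  let ?I = "two_residents f g"
  have m: "matching ?I M" using assms by (simp add: stable_matching_def)
  obtain a b where ab: "(0, a) \<in> M" "(1, b) \<in> M"
    using stable_matching_matched[OF two_residents_marriage assms, of 0]
      stable_matching_matched[OF two_residents_marriage assms, of 1] by auto
  have M: "M = {(0, a), (1, b)}"
  proof
    show "M \<subseteq> {(0, a), (1, b)}"
    proof
      fix x assume x: "x \<in> M"
      obtain r h where rh: "x = (r, h)" by (cases x)
      then have "r = 0 \<or> r = 1" using x m by (auto simp: matching_def)
      then have "r = 0 \<and> h = a \<or> r = 1 \<and> h = b"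
        using x rh ab matching_right_unique[OF m] by blast
      then show "x \<in> {(0, a), (1, b)}" using rh by auto
    qed
  qed (use ab in auto)
  moreover have "hospital_of M 0 = a" "hospital_of M 1 = b"
    using ab hospital_of_eq[OF m] by auto
  ultimately show thesis using that assms two_residents_stable[of f g a b] by blast
qed

lemma two_residents_score:
  assumes "a \<noteq> b" "a < 3" "b < 3"
  shows "score (two_residents f g) {(0, a), (1, b)} = (if a = 2 \<or> b = 2 then 2 else 3)"
proof -
  have "satisfied (two_residents f g) {(0, a), (1, b)} = {2, a, b}"
    using assms by (auto simp: satisfied_def residents_of_def)
  then show ?thesis
    using assms marriage_score[OF two_residents_marriage two_residents_matching[OF assms], of f g]
    by (auto simp: card_insert_if)
qed

section \<open>A run of Double Proposal that attains the ratio\<close>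

definition tight_instance :: instance_data where
  "tight_instance = two_residents (\<lambda>h. if h = 2 then 1 else 0) (\<lambda>h. if h = 1 then 1 else 0)"

lemma tight_instance_sel [simp]:
  "nres tight_instance = 2" "lq tight_instance h = (if h = 2 then 0 else 1)"
  "uq tight_instance h = 1"
  by (simp_all add: tight_instance_def)

text \<open>The run makes no deletion, so the ties of the full lists decide every proposal.\<close>

lemma tight_instance_top_tie:
  assumes "deleted s = {}"
  shows "top_tie tight_instance s 0 = {0, 1}" "top_tie tight_instance s 1 = {0, 2}"
proof -
  have "current_list tight_instance s r = {0, 1, 2}" for r
    using assms by (auto simp: current_list_def tight_instance_def less_3_iff)
  then show "top_tie tight_instance s 0 = {0, 1}" "top_tie tight_instance s 1 = {0, 2}"
    unfolding top_tie_def by (auto simp: tight_instance_def rank_pref_def split: if_splits)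
qed

lemma tight_instance_unmatched_init: "unmatched_residents tight_instance dp_init = {0, 1}"
  by (auto simp: unmatched_residents_def unmatched_def hospitals_of_def dp_init_def)

lemma tight_instance_unmatched:
  "unmatched_residents tight_instance
    \<lparr>asg = {(0, 0)}, proposed = P, rejected = R, deleted = D\<rparr> = {1}"
  by (auto simp: unmatched_residents_def unmatched_def hospitals_of_def)

lemma proposal_targetI:
  assumes "proposal_candidates I s r = C" "{h \<in> C. \<forall>h'\<in>C. lq I h \<le> lq I h'} = T" "Min T = h"
  shows "proposal_target I s r = h"
  using assms by (simp add: proposal_target_def)

lemma tight_instance_step1:
  "dp_step tight_instance dp_init =
    \<lparr>asg = {(0, 0)}, proposed = {(0, 0)}, rejected = {}, deleted = {}\<rparr>"
proof -
  have "top_tie tight_instance dp_init 0 = {0, 1}"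
    by (rule tight_instance_top_tie) (simp add: dp_init_def)
  then have "proposal_candidates tight_instance dp_init 0 = {0, 1}"
    unfolding proposal_candidates_def by (auto simp: dp_init_def)
  then have t: "proposal_target tight_instance dp_init 0 = 0"
    by (rule proposal_targetI[of _ _ _ _ "{0, 1}"]) auto
  have m: "Min (unmatched_residents tight_instance dp_init) = 0"
    by (simp add: tight_instance_unmatched_init)
  show ?thesis
    by (subst dp_step_eq[OF m t, of "{}" "{0}"]) (auto simp: dp_init_def residents_of_def)
qed

lemma tight_instance_step2:
  "dp_step tight_instance \<lparr>asg = {(0, 0)}, proposed = {(0, 0)}, rejected = {}, deleted = {}\<rparr> =
    \<lparr>asg = {(0, 0)}, proposed = {(1, 2), (0, 0)}, rejected = {(1, 2)}, deleted = {}\<rparr>"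
  (is "dp_step _ ?s = _")
proof -
  have "top_tie tight_instance ?s 1 = {0, 2}" by (rule tight_instance_top_tie) simp
  then have "proposal_candidates tight_instance ?s 1 = {0, 2}"
    unfolding proposal_candidates_def by auto
  then have t: "proposal_target tight_instance ?s 1 = 2"
    by (rule proposal_targetI[of _ _ _ _ "{2}"]) auto
  have m: "Min (unmatched_residents tight_instance ?s) = 1"
    by (simp add: tight_instance_unmatched)
  show ?thesis
    by (subst dp_step_eq[OF m t, of "{}" "{1}"]) (auto simp: residents_of_def)
qed

text \<open>Hospital 0 has rejected neither resident yet, so the largest index decides and the
  newcomer is turned away.\<close>

lemma tight_instance_step3:
  "dp_step tight_instance
      \<lparr>asg = {(0, 0)}, proposed = {(1, 2), (0, 0)}, rejected = {(1, 2)}, deleted = {}\<rparr> =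
    \<lparr>asg = {(0, 0)}, proposed = {(1, 0), (1, 2), (0, 0)}, rejected = {(1, 0), (1, 2)},
     deleted = {}\<rparr>"
  (is "dp_step _ ?s = _")
proof -
  have "top_tie tight_instance ?s 1 = {0, 2}" by (rule tight_instance_top_tie) simp
  then have "{h \<in> top_tie tight_instance ?s 1. (1, h) \<notin> proposed ?s} = {0}" by auto
  then have "proposal_candidates tight_instance ?s 1 = {0}"
    unfolding proposal_candidates_def Let_def by simp
  then have t: "proposal_target tight_instance ?s 1 = 0"
    by (rule proposal_targetI[of _ _ _ _ "{0}"]) auto
  have m: "Min (unmatched_residents tight_instance ?s) = 1"
    by (simp add: tight_instance_unmatched)
  have q: "residents_of (asg ?s) 0 = {0}" by (simp add: residents_of_def)
  have "(x, 0) \<notin> rejected ?s" for x :: nat by simp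
  then have F: "{x \<in> insert 1 {0}. (x, 0) \<notin> rejected ?s} = {0, 1}" by blast
  show ?thesis
    unfolding dp_step_eq[OF m t q F] by simp
qed

text \<open>The whole tie has been tried, so the smaller lower quota decides again; the earlier
  rejection by hospital 2 now opens rule (3).\<close>

lemma tight_instance_step4:
  "asg (dp_step tight_instance
      \<lparr>asg = {(0, 0)}, proposed = {(1, 0), (1, 2), (0, 0)}, rejected = {(1, 0), (1, 2)},
       deleted = {}\<rparr>) = {(0, 0), (1, 2)}"
  (is "asg (dp_step _ ?s) = _")
proof -
  have "top_tie tight_instance ?s 1 = {0, 2}" by (rule tight_instance_top_tie) simp
  then have "proposal_candidates tight_instance ?s 1 = {0, 2}"
    unfolding proposal_candidates_def by (auto simp: Let_def)
  then have t: "proposal_target tight_instance ?s 1 = 2"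
    by (rule proposal_targetI[of _ _ _ _ "{2}"]) auto
  have m: "Min (unmatched_residents tight_instance ?s) = 1"
    by (simp add: tight_instance_unmatched)
  show ?thesis
    by (subst dp_step_eq[OF m t, of "{}" "{}"]) (auto simp: residents_of_def)
qed

text \<open>Index order sends resident 0 to hospital 0 instead of the tied hospital 1, which pushes
  resident 1 to hospital 2, where lower quota 0 makes its presence worth nothing.\<close>

lemma double_proposal_tight_instance: "double_proposal tight_instance = {(0, 0), (1, 2)}"
proof -
  let ?s4 = "dp_step tight_instance
      \<lparr>asg = {(0, 0)}, proposed = {(1, 0), (1, 2), (0, 0)}, rejected = {(1, 0), (1, 2)},
       deleted = {}\<rparr>"
  let ?b = "\<lambda>s. unmatched_residents tight_instance s \<noteq> {}"
  have "\<not> unmatched (asg ?s4) r" if "r < 2" for r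
    using that unfolding less_2_iff tight_instance_step4 unmatched_def hospitals_of_def by blast
  then have "unmatched_residents tight_instance ?s4 = {}"
    by (simp only: unmatched_residents_def tight_instance_sel lessThan_iff) blast
  then have stop: "while ?b (dp_step tight_instance) ?s4 = ?s4"
    by (subst while_unfold) simp
  \<comment> \<open>One guarded unfolding per use: a set of the form \<open>insert x X\<close>
    settles the loop test, and the rewriting cannot run on.\<close>
  have continue: "while ?b (dp_step tight_instance) s =
      while ?b (dp_step tight_instance) (dp_step tight_instance s)"
    if "unmatched_residents tight_instance s = insert x X" for s x X
    using that by (subst while_unfold) simp
  have "while ?b (dp_step tight_instance) dp_init = ?s4"
    unfolding continue[OF tight_instance_unmatched_init] tight_instance_step1
      continue[OF tight_instance_unmatched] tight_instance_step2 tight_instance_step3 stop ..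
  then show ?thesis by (simp only: double_proposal_def tight_instance_step4)
qed

lemma tight_instance_ratio: "OPT tight_instance / ALG tight_instance = 3 / 2"
proof -
  have m: "tight_instance \<in> marriage"
    by (simp add: tight_instance_def two_residents_marriage)
  have "ALG tight_instance = 2"
    unfolding ALG_def double_proposal_tight_instance unfolding tight_instance_def
    by (subst two_residents_score) auto
  moreover have "stable_matching tight_instance {(0, 1), (1, 0)}"
    by (auto simp: tight_instance_def two_residents_stable less_3_iff simp del: One_nat_def)
  then have "3 \<le> OPT tight_instance"
    using OPT_ge[of tight_instance "{(0, 1), (1, 0)}"]
    by (simp add: tight_instance_def two_residents_score del: One_nat_def)
  \<comment> \<open>The bound OPT \<le> 3 comes from the general guarantee, so no enumeration of
    stable matchings is required.\<close>
  ultimately show ?thesis using OPT_le_ALG[OF m] by simp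
qed

section \<open>The lower bound under strategy-proofness\<close>

lemma approximate_stable_matching_score:
  assumes "stable_matching (two_residents f g) {(0, a), (1, b)}" "a \<noteq> 2" "b \<noteq> 2"
    and "stable_matching (two_residents f g) M"
    and "OPT (two_residents f g) \<le> c * score (two_residents f g) M" "c < 3 / 2"
  shows "hospital_of M 0 \<noteq> 2" "hospital_of M 1 \<noteq> 2"
proof -
  let ?I = "two_residents f g"
  have "a \<noteq> b" "a < 3" "b < 3" using assms(1) two_residents_stable by auto
  then have "3 \<le> OPT ?I"
    using OPT_ge[OF assms(1)] assms(2,3) by (simp add: two_residents_score del: One_nat_def)
  \<comment> \<open>Score 2 would give OPT \<le> 2c < 3. The remaining score 3 means that hospital 2
    stays empty.\<close>
  then have "score ?I M \<noteq> 2" using assms(5,6) by auto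
  then show "hospital_of M 0 \<noteq> 2" "hospital_of M 1 \<noteq> 2"
    using assms(4) by (auto elim!: two_residents_stable_cases simp: two_residents_score
        simp del: One_nat_def)
qed

text \<open>If both residents rank the hospitals in the order 0, 2, 1, one of them gets hospital 0.
  By reporting 0, 2, 1, this resident would improve on its outcome when its true order is
  0, 1, 2: there the approximation factor forces it into hospital 1.\<close>

lemma no_strategy_proof_approximation:
  assumes stable: "\<And>I. I \<in> marriage \<Longrightarrow> stable_matching I (A I)"
    and sp: "strategy_proof marriage A"
    and c: "c < 3 / 2" "\<And>I. I \<in> marriage \<Longrightarrow> OPT I \<le> c * score I (A I)"
  shows False
proof -
  define f :: "nat \<Rightarrow> nat" where "f = (\<lambda>h. h)"
  \<comment> \<open>\<open>3 - h\<close> exchanges 1 and 2, so \<open>g\<close> ranks in the order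
    0, 2, 1.\<close>
  define g :: "nat \<Rightarrow> nat" where "g = (\<lambda>h. if h = 0 then 0 else 3 - h)"
  note st = stable[OF two_residents_marriage]
  note sp' = sp[unfolded strategy_proof_def, rule_format, OF two_residents_marriage _
      two_residents_marriage]
  have "hospital_of (A (two_residents f g)) 0 = 1"
  proof -
    have "stable_matching (two_residents f g) {(0, 1), (1, 0)}"
      by (auto simp: two_residents_stable f_def g_def less_3_iff simp del: One_nat_def)
    \<comment> \<open>Resident 1 prefers the empty hospital 2 to hospital 1, so stability puts it
      into hospital 0 and leaves hospital 1 to resident 0.\<close>
    from approximate_stable_matching_score[OF this _ _ st c(2)[OF two_residents_marriage] c(1)]
    show ?thesis
      using st[of f g]
      by (auto elim!: two_residents_stable_cases simp: g_def less_3_iff simp del: One_nat_def)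
  qed
  moreover have "two_residents g g = (two_residents f g)
      \<lparr>rpref := (rpref (two_residents f g))(0 := rank_pref {..<3} g)\<rparr>"
    by (simp add: two_residents_def fun_eq_iff)
  from sp'[OF _ this] have "(hospital_of (A (two_residents f g)) 0,
      hospital_of (A (two_residents g g)) 0) \<in> rank_pref {..<3} f" by simp
  ultimately have 0: "hospital_of (A (two_residents g g)) 0 \<noteq> 0"
    by (auto simp: rank_pref_def f_def)
  have "hospital_of (A (two_residents g f)) 1 = 1"
  proof -
    have "stable_matching (two_residents g f) {(0, 0), (1, 1)}"
      by (auto simp: two_residents_stable f_def g_def less_3_iff simp del: One_nat_def)
    from approximate_stable_matching_score[OF this _ _ st c(2)[OF two_residents_marriage] c(1)]
    show ?thesis
      using st[of g f]
      by (auto elim!: two_residents_stable_cases simp: g_def less_3_iff simp del: One_nat_def)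
  qed
  moreover have "two_residents g g = (two_residents g f)
      \<lparr>rpref := (rpref (two_residents g f))(1 := rank_pref {..<3} g)\<rparr>"
    by (simp add: two_residents_def fun_eq_iff)
  from sp'[OF _ this] have "(hospital_of (A (two_residents g f)) 1,
      hospital_of (A (two_residents g g)) 1) \<in> rank_pref {..<3} f" by simp
  ultimately have 1: "hospital_of (A (two_residents g g)) 1 \<noteq> 0"
    by (auto simp: rank_pref_def f_def)
  \<comment> \<open>Hospital 0 is strictly best for both residents, so stability does not allow it
    to be empty.\<close>
  from st[of g g] obtain a b where "a < 3" "b < 3"
    "\<And>h. h < 3 \<Longrightarrow> h \<noteq> a \<Longrightarrow> h \<noteq> b \<Longrightarrow> g a \<le> g h"
    "hospital_of (A (two_residents g g)) 0 = a" "hospital_of (A (two_residents g g)) 1 = b"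
    by (elim two_residents_stable_cases) blast
  then show False using 0 1 by (force simp: g_def)
qed

theorem theorem32:
  shows "((\<exists>I\<in>marriage. OPT I / ALG I = 3 / 2) \<and> (\<forall>I\<in>marriage. OPT I / ALG I \<le> 3 / 2)) \<and>
    \<not> (\<exists>(A :: instance_data \<Rightarrow> assignment) (c :: real).
          (\<forall>I\<in>marriage. stable_matching I (A I)) \<and>
          strategy_proof marriage A \<and>
          c < 3 / 2 \<and>
          (\<forall>I\<in>marriage. OPT I \<le> c * score I (A I)))"
proof (intro conjI)
  have "tight_instance \<in> marriage"
    by (simp add: tight_instance_def two_residents_marriage)
  then show "\<exists>I\<in>marriage. OPT I / ALG I = 3 / 2" using tight_instance_ratio by blast
  show "\<forall>I\<in>marriage. OPT I / ALG I \<le> 3 / 2"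
    using OPT_le_ALG ALG_pos by (simp add: pos_divide_le_eq)
  show "\<not> (\<exists>(A :: instance_data \<Rightarrow> assignment) (c :: real).
          (\<forall>I\<in>marriage. stable_matching I (A I)) \<and> strategy_proof marriage A \<and> c < 3 / 2 \<and>
          (\<forall>I\<in>marriage. OPT I \<le> c * score I (A I)))"
    using no_strategy_proof_approximation by blast
qed

end
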